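(* For every $J \subsetneq [9]$ such that $\pi_J \operatorname{BoolBCK}^{+} \neq \pi_J \operatorname{BoolBCK}$, we have $\operatorname{NRD}(\pi_J \operatorname{BoolBCK} \mid \pi_J \operatorname{BoolBCK}^{+}, n) \ge \Omega(n^{6/5})$.
   Context: $\operatorname{BoolBCK}^{+} \subseteq \{0,1\}^9$ is the set of the six $3\times 3$ permutation matrices written in row-major order: $\{100010001, 010100001, 001010100, 100001010, 001100010, 010001100\}$, and $\operatorname{BoolBCK} = \operatorname{BoolBCK}^{+} \setminus \{100010001\}$. For $J \subseteq [9]$ and a set $T$ of $9$-tuples, $\pi_J T$ is the set of restrictions of the tuples in $T$ to the coordinates in $J$ (in increasing order). For predicates $P \subsetneq Q \subseteq D^r$, an instance is a hypergraph $H=(V,E)$ with $E \subseteq V^r$ (ordered tuples); $H$ is non-redundant for $\operatorname{CSP}(P\mid Q)$ if for every $e\in E$ there is $\psi_e : V \to D$ with $\psi_e(e') \in P$ for all $e' \ne e$ and $\psi_e(e) \in Q \setminus P$ (applying $\psi_e$ coordinatewise). $\operatorname{NRD}(P\mid Q,n)$ is the maximum number of edges of such an instance on $n$ vertices. *)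

theory Defs
  imports Complex_Main "HOL-Library.Landau_Symbols"
begin

text \<open>An r-tuple over a set A is a list of length r with entries in A, so A^r is
  \<open>tuples r A\<close>.\<close>

definition tuples :: "nat \<Rightarrow> 'a set \<Rightarrow> 'a list set" where
  "tuples r A = {t. length t = r \<and> set t \<subseteq> A}"

definition BoolBCK_plus :: "nat list set" where
  "BoolBCK_plus =
    {[1,0,0, 0,1,0, 0,0,1],
     [0,1,0, 1,0,0, 0,0,1],
     [0,0,1, 0,1,0, 1,0,0],
     [1,0,0, 0,0,1, 0,1,0],
     [0,0,1, 1,0,0, 0,1,0],
     [0,1,0, 0,0,1, 1,0,0]}"

definition BoolBCK :: "nat list set" where
  "BoolBCK = BoolBCK_plus - {[1,0,0, 0,1,0, 0,0,1]}"

text \<open>Coordinates are numbered from 1, whereas list positions are numbered from 0.\<close>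

definition proj :: "nat set \<Rightarrow> 'a list set \<Rightarrow> 'a list set" where
  "proj J T = (\<lambda>t. nths t {i. Suc i \<in> J}) ` T"

definition nonredundant ::
  "'d set \<Rightarrow> nat \<Rightarrow> 'd list set \<Rightarrow> 'd list set \<Rightarrow> 'v set \<Rightarrow> 'v list set \<Rightarrow> bool" where
  "nonredundant D r P Q V E \<longleftrightarrow>
     E \<subseteq> tuples r V \<and>
     (\<forall>e\<in>E. \<exists>\<psi>. \<psi> ` V \<subseteq> D \<and> (\<forall>e'\<in>E. e' \<noteq> e \<longrightarrow> map \<psi> e' \<in> P) \<and> map \<psi> e \<in> Q - P)"

text \<open>Vertices are taken from nat; this loses nothing, since only finite vertex sets occur and
  non-redundancy is invariant under renaming vertices.\<close>

definition NRD_sizes :: "'d set \<Rightarrow> nat \<Rightarrow> 'd list set \<Rightarrow> 'd list set \<Rightarrow> nat \<Rightarrow> nat set" where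
  "NRD_sizes D r P Q n =
     {card E |(V :: nat set) E. finite V \<and> card V = n \<and> nonredundant D r P Q V E}"

definition NRD :: "'d set \<Rightarrow> nat \<Rightarrow> 'd list set \<Rightarrow> 'd list set \<Rightarrow> nat \<Rightarrow> nat" where
  "NRD D r P Q n = Max (NRD_sizes D r P Q n)"

text \<open>The maximum ranges over a finite nonempty set.\<close>

lemma finite_NRD_sizes: "finite (NRD_sizes D r P Q n)"
proof (rule finite_subset)
  show "NRD_sizes D r P Q n \<subseteq> {..n ^ r}"
  proof
    fix k assume "k \<in> NRD_sizes D r P Q n"
    then obtain V :: "nat set" and E where VE: "k = card E" "finite V" "card V = n"
      and E: "E \<subseteq> tuples r V"
      unfolding NRD_sizes_def nonredundant_def by blast
    have "tuples r V = {t. set t \<subseteq> V \<and> length t = r}"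
      unfolding tuples_def by (rule Collect_cong) (rule conj_commute)
    then have "finite (tuples r V)" "card (tuples r V) = n ^ r"
      using finite_lists_length_eq[OF VE(2)] card_lists_length_eq[OF VE(2)] VE(3) by simp_all
    then show "k \<in> {..n ^ r}"
      using card_mono[OF _ E] VE(1) by simp
  qed
qed simp

lemma NRD_sizes_nonempty: "0 \<in> NRD_sizes D r P Q n"
  unfolding NRD_sizes_def nonredundant_def
  by (rule CollectI, rule exI[of _ "{..<n}"], rule exI[of _ "{}"]) simp

end

theory Submission
  imports Defs "HOL-Algebra.Algebraic_Closure_Type" "HOL-Library.Z2"
begin

text \<open>
  Removing one coordinate from a permutation matrix loses no information, and projecting further only
  merges more, so it suffices to treat the case that a single matrix position \<open>c0\<close> is unconstrained.
  Let \<open>F\<close> be the flags (incident point-line pairs) of the affine plane over a field with \<open>q\<close> elements,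
  vertical lines omitted: \<open>q^3\<close> flags on \<open>q^2\<close> points and \<open>q^2\<close> lines, without 4-cycles. The edges
  of the instance are the \<open>q^6\<close> pairs of flags; the vertex an edge uses at a matrix position is obtained
  by forgetting the point or the line of one of the two flags, which leaves \<open>O(q^5)\<close> vertices.

  As in a projective plane, regarded as a building of type \<open>A2\<close>, the position of a flag relative to a
  fixed one takes six values, arranged in a hexagon: changing only the point or only the line of a flag
  moves it within an alternate side of the hexagon. An assignment that separates one edge from all others
  thus amounts to a 6 by 6 table of permutation matrices, with the identity only at the origin, whose
  entry at each position other than \<open>c0\<close> is constant along one of the four families of sides. Such tables
  exist for \<open>c0\<close> on and off the diagonal, and the other cases follow by symmetry.
\<close>

section \<open>Lower bounds from families of assignments\<close>

lemma nths_conv_map_nth: "nths xs A = map ((!) xs) (filter (\<lambda>i. i \<in> A) [0..<length xs])"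
proof -
  have "nths xs A = nths (map ((!) xs) [0..<length xs]) A"
    by (simp add: map_nth)
  also have "\<dots> = map ((!) xs) (nths [0..<length xs] A)"
    by (rule nths_map)
  also have "nths [0..<n] A = filter (\<lambda>i. i \<in> A) [0..<n]" for n
    by (induction n) (auto simp: nths_append)
  finally show ?thesis .
qed

lemma nonredundant_card_le_NRD:
  assumes "nonredundant D r P Q V E" "finite V" "card (V :: nat set) = n"
  shows "card E \<le> NRD D r P Q n"
  unfolding NRD_def
  by (rule Max_ge[OF finite_NRD_sizes]) (use assms in \<open>auto simp: NRD_sizes_def\<close>)

text \<open>Reduces a lower bound to a matrix-valued function: each \<open>x\<close> in
  \<open>A\<close> becomes an edge whose vertex at position \<open>c\<close> is
  \<open>f c x\<close>, tagged with \<open>c\<close>, and \<open>M e x\<close> is the tuple that the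
  assignment for \<open>e\<close> produces on edge \<open>x\<close>. The hypothesis
  \<open>compat\<close> makes that assignment well defined on vertices.\<close>

lemma card_le_NRD_proj:
  fixes f :: "nat \<Rightarrow> 'x \<Rightarrow> 'v"
  assumes J: "J \<subseteq> {1..N}" and Q: "Q \<subseteq> tuples N D" and "D \<noteq> {}"
    and t0: "t0 \<in> Q" "proj J Q \<noteq> proj J (Q - {t0})"
    and "finite A"
    and M: "\<And>e x. e \<in> A \<Longrightarrow> x \<in> A \<Longrightarrow> M e x \<in> Q"
      "\<And>e x. e \<in> A \<Longrightarrow> x \<in> A \<Longrightarrow> M e x = t0 \<longleftrightarrow> x = e"
    and compat: "\<And>e x y c. e \<in> A \<Longrightarrow> x \<in> A \<Longrightarrow> y \<in> A \<Longrightarrow> Suc c \<in> J \<Longrightarrow> f c x = f c y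
      \<Longrightarrow> M e x ! c = M e y ! c"
    and n: "(\<Sum>c | Suc c \<in> J. card (f c ` A)) \<le> n"
  shows "card A \<le> NRD D (card J) (proj J (Q - {t0})) (proj J Q) n"
proof -
  define I where "I = {c. Suc c \<in> J}"
  have I: "I \<subseteq> {..<N}"
    using J by (force simp: I_def)
  then have "finite I"
    by (rule finite_subset) simp
  have "J = Suc ` I"
    using J by (auto simp: I_def image_iff) (metis Suc_pred' atLeastAtMost_iff less_eq_Suc_le subsetD One_nat_def)
  then have card_J: "card J = card I"
    by (simp add: card_image)
  define cs where "cs = filter (\<lambda>c. c \<in> I) [0..<N]"
  have cs: "set cs = I" "length cs = card I"
  proof -
    show "set cs = I"
      using I by (auto simp: cs_def)
    then show "length cs = card I"
      using distinct_card[of cs] by (simp add: cs_def)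
  qed
  have nths_Q: "nths t I = map ((!) t) cs" if "t \<in> Q" for t
    using that Q by (auto simp: nths_conv_map_nth cs_def tuples_def)
  have nth_Q: "t ! c \<in> D" if "t \<in> Q" "c \<in> I" for t c
    using that Q I by (force simp: tuples_def subset_iff)
  \<comment> \<open>Another tuple with the same restriction would make up for the removal of
    \<open>t0\<close>, so both projections would agree.\<close>
  have t0_inj: "nths t I \<noteq> nths t0 I" if "t \<in> Q" "t \<noteq> t0" for t
  proof
    assume "nths t I = nths t0 I"
    then have "nths t0 I \<in> proj J (Q - {t0})"
      unfolding proj_def I_def[symmetric] using that by (metis DiffI imageI singletonD)
    then have "proj J Q \<subseteq> proj J (Q - {t0})"
      unfolding proj_def I_def[symmetric] by auto
    with t0(2) show False
      by (auto simp: proj_def)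
  qed
  define U where "U = Sigma I (\<lambda>c. f c ` A)"
  have "finite U"
    using \<open>finite I\<close> \<open>finite A\<close> by (simp add: U_def)
  then obtain g where g: "bij_betw g U {0..<card U}"
    using ex_bij_betw_finite_nat by blast
  have "card U \<le> n"
    using n \<open>finite I\<close> \<open>finite A\<close> by (simp add: U_def I_def)
  obtain d where "d \<in> D"
    using \<open>D \<noteq> {}\<close> by blast
  define edge where "edge x = map (\<lambda>c. g (c, f c x)) cs" for x
  \<comment> \<open>\<open>SOME\<close> picks any edge through the vertex; by \<open>compat\<close>
    the choice is immaterial. The value \<open>d\<close> goes to the vertices that pad the instance
    to exactly \<open>n\<close>.\<close>
  define \<psi> where "\<psi> e v = (if v \<in> g ` U then
      case inv_into U g v of (c, u) \<Rightarrow> M e (SOME x. x \<in> A \<and> f c x = u) ! c else d)" for e v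
  have \<psi>: "\<psi> e (g (c, f c x)) = M e x ! c" if "e \<in> A" "x \<in> A" "c \<in> I" for e x c
  proof -
    have "(c, f c x) \<in> U"
      using that by (simp add: U_def)
    moreover from this have "inv_into U g (g (c, f c x)) = (c, f c x)"
      using g by (simp add: bij_betw_def inv_into_f_f)
    moreover define y where "y = (SOME y. y \<in> A \<and> f c y = f c x)"
    moreover have "y \<in> A \<and> f c y = f c x"
      unfolding y_def by (rule someI[where x = x]) (use that in simp)
    then have "M e y ! c = M e x ! c"
      using that by (intro compat) (auto simp: I_def)
    ultimately show ?thesis
      by (simp add: \<psi>_def)
  qed
  have map_\<psi>: "map (\<psi> e) (edge x) = nths (M e x) I" if "e \<in> A" "x \<in> A" for e x
    using that M(1)[OF that] by (simp add: edge_def nths_Q \<psi> cs)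
  have \<psi>_D: "\<psi> e v \<in> D" if "e \<in> A" for e v
  proof (cases "v \<in> g ` U")
    case True
    then obtain c x where "v = g (c, f c x)" "c \<in> I" "x \<in> A"
      by (auto simp: U_def)
    then show ?thesis
      using that by (simp add: \<psi> nth_Q M(1))
  next
    case False
    then show ?thesis
      using \<open>d \<in> D\<close> by (simp add: \<psi>_def)
  qed
  have "nonredundant D (card J) (proj J (Q - {t0})) (proj J Q) {..<n} (edge ` A)"
    unfolding nonredundant_def
  proof (intro conjI ballI)
    have "g u < n" if "u \<in> U" for u
      using bij_betwE[OF g] that \<open>card U \<le> n\<close> by fastforce
    then show "edge ` A \<subseteq> tuples (card J) {..<n}"
      by (auto simp: edge_def tuples_def cs card_J U_def)
  next
    fix e' assume "e' \<in> edge ` A"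
    then obtain e where e: "e \<in> A" "e' = edge e"
      by blast
    have "map (\<psi> e) (edge x) \<in> proj J (Q - {t0})" if "x \<in> A" "edge x \<noteq> edge e" for x
    proof -
      have "M e x \<in> Q - {t0}"
        using M[OF e(1) that(1)] that(2) by auto
      then show ?thesis
        using e that by (auto simp: map_\<psi> proj_def I_def)
    qed
    moreover have "map (\<psi> e) (edge e) \<in> proj J Q - proj J (Q - {t0})"
    proof -
      have "M e e = t0"
        using M(2) e by blast
      then show ?thesis
        using e t0(1) t0_inj by (simp add: map_\<psi>) (force simp: proj_def I_def[symmetric])
    qed
    ultimately show "\<exists>\<psi>. \<psi> ` {..<n} \<subseteq> D \<and>
        (\<forall>e''\<in>edge ` A. e'' \<noteq> e' \<longrightarrow> map \<psi> e'' \<in> proj J (Q - {t0})) \<and>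
        map \<psi> e' \<in> proj J Q - proj J (Q - {t0})"
      using \<psi>_D[OF e(1)] e by (intro exI[of _ "\<psi> e"]) auto
  qed
  moreover have "inj_on edge A"
  proof (rule inj_onI)
    fix x y assume "x \<in> A" "y \<in> A" "edge x = edge y"
    then have "nths (M x x) I = nths (M x y) I"
      using map_\<psi> by metis
    then show "x = y"
      using M t0_inj \<open>x \<in> A\<close> \<open>y \<in> A\<close> by metis
  qed
  ultimately show ?thesis
    using nonredundant_card_le_NRD[of D "card J" _ _ "{..<n}" "edge ` A"] by (simp add: card_image)
qed

subsection \<open>Relative position of flags\<close>

text \<open>The values 0 to 5 number the hexagon cyclically; the sides with a common line are
  \<open>{0, 1}, {2, 3}, {4, 5}\<close>, those with a common point are \<open>{1, 2}, {3, 4}, {5, 0}\<close>.\<close>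

definition flag_dist :: "('p \<times> 'l) set \<Rightarrow> 'p \<times> 'l \<Rightarrow> 'p \<times> 'l \<Rightarrow> nat" where
  "flag_dist F = (\<lambda>(p0, l0) (p, l).
     if l = l0 then (if p = p0 then 0 else 1)
     else if p = p0 then 5
     else if (p, l0) \<in> F then 2
     else if (p0, l) \<in> F then 4
     else 3)"

definition C4_free :: "('p \<times> 'l) set \<Rightarrow> bool" where
  "C4_free F \<longleftrightarrow> (\<forall>p p' l l'. (p, l) \<in> F \<longrightarrow> (p, l') \<in> F \<longrightarrow> (p', l) \<in> F \<longrightarrow> (p', l') \<in> F
     \<longrightarrow> p = p' \<or> l = l')"

lemma flag_dist_less: "flag_dist F e x < 6"
  by (simp add: flag_dist_def split: prod.split)

lemma flag_dist_eq_0_iff: "flag_dist F e x = 0 \<longleftrightarrow> x = e"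
  by (auto simp: flag_dist_def split: prod.splits)

text \<open>With \<open>e = (p0, l0)\<close>, the side depends only on the line \<open>l\<close>: it
  is \<open>l0\<close>, or another line through \<open>p0\<close>, or neither. Values 2 and 4 cannot
  compete, since \<open>(p, l0)\<close> and \<open>(p0, l)\<close> both in \<open>F\<close> would
  close a 4-cycle.\<close>

lemma flag_dist_same_line:
  assumes "C4_free F" "e \<in> F" "x \<in> F" "y \<in> F" "snd x = snd y"
  shows "flag_dist F e x div 2 = flag_dist F e y div 2"
  using assms unfolding C4_free_def
  by (cases e; cases x; cases y) (auto simp: flag_dist_def; metis)

text \<open>Dually, the side depends on whether the point is \<open>p0\<close>, another point of
  \<open>l0\<close>, or neither; \<open>mod 3\<close> joins 5 to 0.\<close>

lemma flag_dist_same_point: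
  assumes "C4_free F" "e \<in> F" "x \<in> F" "y \<in> F" "fst x = fst y"
  shows "(flag_dist F e x + 1) div 2 mod 3 = (flag_dist F e y + 1) div 2 mod 3"
  using assms unfolding C4_free_def
  by (cases e; cases x; cases y) (auto simp: flag_dist_def; metis)

subsection \<open>Tables of permutation matrices\<close>

text \<open>Replaces one component by the even end of its side of the hexagon; \<open>k\<close> selects the component and
  the family of sides.\<close>

fun panel :: "nat \<Rightarrow> nat \<times> nat \<Rightarrow> nat \<times> nat" where
  "panel k (a, b) =
    (if k = 0 then (2 * (a div 2), b)
     else if k = 1 then (2 * ((a + 1) div 2 mod 3), b)
     else if k = 2 then (a, 2 * (b div 2))
     else (a, 2 * ((b + 1) div 2 mod 3)))"

abbreviation id_matrix :: "nat list" where
  "id_matrix \<equiv> [1,0,0, 0,1,0, 0,0,1]"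

text \<open>Comparing each entry with the one at the even end of its side expresses constancy along
  sides. The position \<open>(0, 0)\<close> is that of an edge relative to itself.\<close>

definition scheme_on :: "nat \<Rightarrow> (nat \<Rightarrow> nat) \<Rightarrow> (nat \<times> nat \<Rightarrow> nat list) \<Rightarrow> bool" where
  "scheme_on c0 \<kappa> T \<longleftrightarrow>
    (\<forall>w\<in>{..<6} \<times> {..<6}. T w \<in> BoolBCK_plus \<and> (T w = id_matrix \<longleftrightarrow> w = (0, 0)) \<and>
      (\<forall>c<9. c \<noteq> c0 \<longrightarrow> T w ! c = T (panel (\<kappa> c) w) ! c))"

abbreviation "scheme c0 \<equiv> \<exists>\<kappa> T. scheme_on c0 \<kappa> T"

lemma scheme_onD:
  assumes "scheme_on c0 \<kappa> T" "w \<in> {..<6} \<times> {..<6}"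
  shows "T w \<in> BoolBCK_plus" "T w = id_matrix \<longleftrightarrow> w = (0, 0)"
    and "c < 9 \<Longrightarrow> c \<noteq> c0 \<Longrightarrow> T w ! c = T (panel (\<kappa> c) w) ! c"
  using bspec[OF assms(1)[unfolded scheme_on_def] assms(2)] by simp_all

definition perms :: "nat list list" where
  "perms = [[1,0,0, 0,1,0, 0,0,1],
     [0,1,0, 1,0,0, 0,0,1],
     [0,0,1, 0,1,0, 1,0,0],
     [1,0,0, 0,0,1, 0,1,0],
     [0,0,1, 1,0,0, 0,1,0],
     [0,1,0, 0,0,1, 1,0,0]]"

lemma set_perms: "BoolBCK_plus = set perms"
  by (simp add: BoolBCK_plus_def perms_def)

text \<open>Rows and columns are exchanged simultaneously, here and in \<open>swap23\<close>, so
  that the identity matrix stays fixed.\<close>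

abbreviation "swap12 \<equiv> [4,3,5, 1,0,2, 7,6,8::nat]"

abbreviation "swap23 \<equiv> [0,2,1, 6,8,7, 3,5,4::nat]"

abbreviation "transposition \<equiv> [0,3,6, 1,4,7, 2,5,8::nat]"

lemma relabelings_valid:
  "list_all (\<lambda>\<tau>. distinct \<tau> \<and> length \<tau> = 9 \<and> list_all (\<lambda>c. c < 9) \<tau> \<and>
     list_all (\<lambda>t. map ((!) t) \<tau> \<in> set perms \<and> (map ((!) t) \<tau> = id_matrix \<longleftrightarrow> t = id_matrix)) perms)
   [swap12, swap23, transposition]"
  by (simp add: perms_def)

lemma scheme_relabel:
  assumes "scheme (\<tau> ! c1)" "\<tau> \<in> {swap12, swap23, transposition}" "c1 < 9"
  shows "scheme c1"
proof -
  have \<tau>: "distinct \<tau>" "length \<tau> = 9" "\<And>c. c < 9 \<Longrightarrow> \<tau> ! c < 9"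
    and perm: "t \<in> BoolBCK_plus \<Longrightarrow> map ((!) t) \<tau> \<in> BoolBCK_plus"
      "t \<in> BoolBCK_plus \<Longrightarrow> map ((!) t) \<tau> = id_matrix \<longleftrightarrow> t = id_matrix" for t
    using bspec[OF relabelings_valid[unfolded list_all_iff], of \<tau>] assms(2)
    unfolding set_perms by auto
  from assms(1) obtain \<kappa> T where T: "scheme_on (\<tau> ! c1) \<kappa> T"
    by (elim exE)
  have "scheme_on c1 (\<lambda>c. \<kappa> (\<tau> ! c)) (\<lambda>w. map ((!) (T w)) \<tau>)"
    unfolding scheme_on_def
  proof (intro ballI conjI allI impI)
    fix w :: "nat \<times> nat" assume w: "w \<in> {..<6} \<times> {..<6}"
    note D = scheme_onD[OF T w]
    show "map ((!) (T w)) \<tau> \<in> BoolBCK_plus"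
      using D(1) by (rule perm)
    show "map ((!) (T w)) \<tau> = id_matrix \<longleftrightarrow> w = (0, 0)"
      unfolding perm(2)[OF D(1)] by (rule D(2))
    fix c :: nat assume "c < 9" "c \<noteq> c1"
    then have "\<tau> ! c \<noteq> \<tau> ! c1"
      using \<tau>(1,2) assms(3) by (simp add: nth_eq_iff_index_eq)
    then have "T w ! (\<tau> ! c) = T (panel (\<kappa> (\<tau> ! c)) w) ! (\<tau> ! c)"
      using D(3) \<tau>(3) \<open>c < 9\<close> by metis
    then show "map ((!) (T w)) \<tau> ! c = map ((!) (T (panel (\<kappa> (\<tau> ! c)) w))) \<tau> ! c"
      using \<open>c < 9\<close> \<tau>(2) by simp
  qed
  then show ?thesis
    by (intro exI)
qed

definition table :: "nat list list \<Rightarrow> nat \<times> nat \<Rightarrow> nat list" where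
  "table t = (\<lambda>(a, b). perms ! (t ! a ! b))"

lemma perms_nth:
  "perms ! 0 = [1,0,0, 0,1,0, 0,0,1]"
  "perms ! Suc 0 = [0,1,0, 1,0,0, 0,0,1]"
  "perms ! 2 = [0,0,1, 0,1,0, 1,0,0]"
  "perms ! 3 = [1,0,0, 0,0,1, 0,1,0]"
  "perms ! 4 = [0,0,1, 1,0,0, 0,1,0]"
  "perms ! 5 = [0,1,0, 0,0,1, 1,0,0]"
  by (simp_all add: perms_def)

text \<open>Leaves a finite check that \<open>simp\<close> can evaluate. As \<open>perms\<close> is
  distinct, being the identity is tested on indices.\<close>

lemma scheme_on_table:
  assumes "list_all (\<lambda>w. (case w of (a, b) \<Rightarrow> t ! a ! b < 6 \<and> (t ! a ! b = 0 \<longleftrightarrow> a = 0 \<and> b = 0)) \<and>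
     list_all (\<lambda>c. c = c0 \<or> table t w ! c = table t (panel (\<kappa> c) w) ! c) [0,1,2,3,4,5,6,7,8])
     (List.product [0,1,2,3,4,5] [0,1,2,3,4,5])"
  shows "scheme_on c0 \<kappa> (table t)"
proof -
  have 6: "set [0,1,2,3,4,5] = {..<6::nat}" and 9: "set [0,1,2,3,4,5,6,7,8] = {..<9::nat}"
    by (auto simp: lessThan_nat_numeral)
  note all = assms[unfolded list_all_iff set_product 6 9]
  have "table t w \<in> BoolBCK_plus \<and> (table t w = id_matrix \<longleftrightarrow> w = (0, 0))"
    if "w \<in> {..<6} \<times> {..<6}" for w
  proof -
    obtain a b where w: "w = (a, b)"
      by (cases w)
    have ab: "t ! a ! b < 6" "t ! a ! b = 0 \<longleftrightarrow> a = 0 \<and> b = 0"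
      using bspec[OF all that] by (simp_all add: w)
    have perms: "length perms = 6" "distinct perms" "perms ! 0 = id_matrix"
      by (simp_all add: perms_def)
    then have "perms ! (t ! a ! b) = perms ! 0 \<longleftrightarrow> t ! a ! b = 0"
      using ab(1) by (intro nth_eq_iff_index_eq) simp_all
    moreover have "perms ! (t ! a ! b) \<in> set perms"
      using ab(1) perms(1) by (intro nth_mem) simp
    ultimately show ?thesis
      using ab(2) perms(3) by (simp add: set_perms table_def w)
  qed
  moreover have "table t w ! c = table t (panel (\<kappa> c) w) ! c"
    if "w \<in> {..<6} \<times> {..<6}" "c < 9" "c \<noteq> c0" for w c
    using bspec[OF all that(1)] that(2,3) by (metis lessThan_iff)
  ultimately show ?thesis
    unfolding scheme_on_def by simp
qed

text \<open>The two tables, and the assignment of panel families to matrix positions, were found by a SAT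
  solver.\<close>

definition table_0 :: "nat list list" where
  "table_0 =
     [[0,1,5,3,4,2],
      [1,1,5,3,3,5],
      [4,4,3,3,3,3],
      [3,3,4,4,3,3],
      [5,3,4,4,3,5],
      [2,4,3,3,4,2]]"

lemma table_0_nth:
  "table_0 ! 0 = [0,1,5,3,4,2]" "table_0 ! Suc 0 = [1,1,5,3,3,5]" "table_0 ! 2 = [4,4,3,3,3,3]"
  "table_0 ! 3 = [3,3,4,4,3,3]" "table_0 ! 4 = [5,3,4,4,3,5]" "table_0 ! 5 = [2,4,3,3,4,2]"
  by (simp_all add: table_0_def)

lemma scheme_0: "scheme 0"
proof (intro exI)
  show "scheme_on 0 ((!) [0,3,2, 1,1,1, 0,3,0]) (table table_0)"
    by (rule scheme_on_table) (simp add: perms_nth table_def table_0_nth)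
qed

definition table_1 :: "nat list list" where
  "table_1 =
     [[0,3,5,2,4,1],
      [2,5,5,2,4,4],
      [5,5,5,5,3,3],
      [3,3,5,5,3,3],
      [4,4,2,2,4,4],
      [1,4,2,2,4,1]]"

lemma table_1_nth:
  "table_1 ! 0 = [0,3,5,2,4,1]" "table_1 ! Suc 0 = [2,5,5,2,4,4]" "table_1 ! 2 = [5,5,5,5,3,3]"
  "table_1 ! 3 = [3,3,5,5,3,3]" "table_1 ! 4 = [4,4,2,2,4,4]" "table_1 ! 5 = [1,4,2,2,4,1]"
  by (simp_all add: table_1_def)

lemma scheme_1: "scheme 1"
proof (intro exI)
  show "scheme_on 1 ((!) [2,0,3, 2,0,3, 1,1,1]) (table table_1)"
    by (rule scheme_on_table) (simp add: perms_nth table_def table_1_nth)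
qed

text \<open>The relabelings have two orbits on positions, the diagonal and its complement,
  represented by 0 and 1.\<close>

lemma scheme_exists:
  assumes "c < 9"
  shows "scheme c"
proof -
  have 4: "scheme 4"
    using scheme_relabel[of swap12 4] scheme_0 by simp
  have 8: "scheme 8"
    using scheme_relabel[of swap23 8] 4 by simp
  have 2: "scheme 2"
    using scheme_relabel[of swap23 2] scheme_1 by simp
  have 3: "scheme 3"
    using scheme_relabel[of transposition 3] scheme_1 by simp
  have 5: "scheme 5"
    using scheme_relabel[of swap12 5] 2 by simp
  have 6: "scheme 6"
    using scheme_relabel[of transposition 6] 2 by simp
  have 7: "scheme 7"
    using scheme_relabel[of swap12 7] 6 by simp
  have "c \<in> {0, 1, 2, 3, 4, 5, 6, 7, 8}"
    using assms by auto
  then show ?thesis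
    using scheme_0 scheme_1 2 3 4 5 6 7 8 by (elim insertE emptyE) (simp_all only:)
qed

subsection \<open>The instance\<close>

text \<open>The numbering by \<open>k\<close> matches that of \<open>panel\<close>.\<close>

definition vertex :: "nat \<Rightarrow> ('a \<times> 'a) \<times> ('a \<times> 'a) \<Rightarrow> 'a \<times> ('a \<times> 'a)" where
  "vertex k = (\<lambda>(x, y).
     if k = 0 then (snd x, y)
     else if k = 1 then (fst x, y)
     else if k = 2 then (snd y, x)
     else (fst y, x))"

text \<open>Edges sharing a vertex agree in one flag and have a common point or line in the other,
  so their relative positions lie on one side.\<close>

lemma panel_flag_dist:
  assumes "C4_free F" "{e, x, y} \<subseteq> F \<times> F" "vertex k x = vertex k y"
  shows "panel k (flag_dist F (fst e) (fst x), flag_dist F (snd e) (snd x)) =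
    panel k (flag_dist F (fst e) (fst y), flag_dist F (snd e) (snd y))"
proof -
  have "fst e \<in> F" "snd e \<in> F" "fst x \<in> F" "snd x \<in> F" "fst y \<in> F" "snd y \<in> F"
    using assms(2) by auto
  note same_line = flag_dist_same_line[OF assms(1)] and same_point = flag_dist_same_point[OF assms(1)]
  consider "k = 0" "snd (fst x) = snd (fst y)" "snd x = snd y"
    | "k = 1" "fst (fst x) = fst (fst y)" "snd x = snd y"
    | "k = 2" "snd (snd x) = snd (snd y)" "fst x = fst y"
    | "k > 2" "fst (snd x) = fst (snd y)" "fst x = fst y"
  proof -
    have "k = 0 \<or> k = 1 \<or> k = 2 \<or> k > 2"
      by arith
    then show ?thesis
      using assms(3) that by (elim disjE) (simp_all add: vertex_def split_beta)
  qed
  then show ?thesis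
  proof cases
    case 1
    then show ?thesis
      using same_line[of "fst e" "fst x" "fst y"] \<open>fst e \<in> F\<close> \<open>fst x \<in> F\<close> \<open>fst y \<in> F\<close> by simp
  next
    case 2
    then show ?thesis
      using same_point[of "fst e" "fst x" "fst y"] \<open>fst e \<in> F\<close> \<open>fst x \<in> F\<close> \<open>fst y \<in> F\<close> by simp
  next
    case 3
    then show ?thesis
      using same_line[of "snd e" "snd x" "snd y"] \<open>snd e \<in> F\<close> \<open>snd x \<in> F\<close> \<open>snd y \<in> F\<close> by simp
  next
    case 4
    then show ?thesis
      using same_point[of "snd e" "snd x" "snd y"] \<open>snd e \<in> F\<close> \<open>snd x \<in> F\<close> \<open>snd y \<in> F\<close> by simp
  qed
qed

lemma card_vertex_image_le:
  assumes "finite F" "card (fst ` F) \<le> b" "card (snd ` F) \<le> b"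
  shows "card (vertex k ` (F \<times> F)) \<le> b * card F"
proof -
  let ?V = "if k = 0 \<or> k = 2 then snd ` F else fst ` F"
  have "vertex k ` (F \<times> F) \<subseteq> ?V \<times> F"
    by (force simp: vertex_def split: if_splits)
  then have "card (vertex k ` (F \<times> F)) \<le> card (?V \<times> F)"
    using assms(1) by (intro card_mono) auto
  also have "\<dots> \<le> b * card F"
    unfolding card_cartesian_product using assms by (intro mult_right_mono) auto
  finally show ?thesis .
qed

subsection \<open>A dense graph without 4-cycles\<close>

text \<open>With \<open>q\<close> the given power, X^q - X splits over an algebraically closed
  field, and its derivative -1 rules out double roots.\<close>

lemma card_pow_CHAR_fixpoints:
  fixes k :: nat
  assumes "CHAR('a :: alg_closed_field) > 0" and "k > 0"
  shows "card {x :: 'a. x ^ CHAR('a) ^ k = x} = CHAR('a) ^ k"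
proof -
  define q where "q = CHAR('a) ^ k"
  define p :: "'a poly" where "p = monom 1 q - monom 1 1"
  have prime: "prime CHAR('a)"
    using assms(1) by (rule prime_CHAR_semidom)
  then have "q > 1"
    unfolding q_def using assms(2) by (meson one_less_power prime_gt_1_nat)
  have coeff: "coeff p q = 1" "\<And>i. i > q \<Longrightarrow> coeff p i = 0"
    using \<open>q > 1\<close> by (auto simp: p_def)
  then have deg: "degree p = q"
    by (intro antisym degree_le le_degree) auto
  have "p \<noteq> 0"
    using coeff(1) by auto
  have poly_p: "poly p x = x ^ q - x" for x
    by (simp add: p_def poly_monom)
  have "of_nat q = (0 :: 'a)"
    using assms(2) by (simp add: q_def)
  then have "pderiv p = -1"
    by (simp add: p_def pderiv_diff pderiv_monom flip: one_pCons)
  obtain A where A: "size A = degree p" "p = smult (lead_coeff p) (\<Prod>x\<in>#A. [:-x, 1:])"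
    using alg_closed_imp_factorization[OF \<open>p \<noteq> 0\<close>] by auto
  have "count A x \<le> 1" for x
  proof (rule ccontr)
    assume "\<not> count A x \<le> 1"
    then have "{#x, x#} \<subseteq># A"
      by (simp add: subseteq_mset_def)
    then have "(\<Prod>x\<in>#{#x, x#}. [:-x, 1:]) dvd (\<Prod>x\<in>#A. [:-x, 1:])"
      by (intro prod_mset_subset_imp_dvd image_mset_subseteq_mono)
    then have "[:-x, 1:] * [:-x, 1:] dvd smult (lead_coeff p) (\<Prod>x\<in>#A. [:-x, 1:])"
      by (intro dvd_smult) simp
    then have "[:-x, 1:] * [:-x, 1:] dvd p"
      by (simp only: A(2)[symmetric])
    then obtain r where "p = [:-x, 1:] * [:-x, 1:] * r" ..
    then have "poly (pderiv p) x = 0"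
      by (simp only: pderiv_mult poly_add poly_mult) simp
    with \<open>pderiv p = -1\<close> show False
      by simp
  qed
  then have "size A = card (set_mset A)"
    by (simp add: size_multiset_overloaded_eq)
      (metis (no_types, lifting) One_nat_def card_eq_sum count_eq_zero_iff le_Suc_eq le_zero_eq sum.cong)
  moreover have "set_mset A = {x. x ^ q = x}"
  proof -
    have "poly p x = 0 \<longleftrightarrow> x \<in># A" for x
      by (subst A(2)) (use \<open>p \<noteq> 0\<close> in \<open>auto simp: poly_prod_mset prod_mset_zero_iff\<close>)
    then show ?thesis
      by (auto simp: poly_p)
  qed
  ultimately show ?thesis
    using A(1) deg unfolding q_def by simp
qed

text \<open>The witness is the fixed set of the \<open>k\<close>-th power of Frobenius, a copy of
  the field with \<open>2 ^ k\<close> elements.\<close>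

lemma finite_subfield_exists:
  fixes k :: nat
  assumes "k > 0"
  obtains K :: "bit alg_closure set"
  where "card K = 2 ^ k" and "\<And>x y. x \<in> K \<Longrightarrow> y \<in> K \<Longrightarrow> x + y \<in> K"
    and "\<And>x y. x \<in> K \<Longrightarrow> y \<in> K \<Longrightarrow> x * y \<in> K"
proof
  have "CHAR(bit) = 2"
    by (rule CHAR_eq_posI) (auto simp: less_2_cases_iff)
  then have char: "CHAR(bit alg_closure) = 2"
    by simp
  let ?K = "{x :: bit alg_closure. x ^ 2 ^ k = x}"
  show "card ?K = 2 ^ k"
    using card_pow_CHAR_fixpoints[where ?'a = "bit alg_closure", OF _ assms] char by simp
  show "x + y \<in> ?K" if "x \<in> ?K" "y \<in> ?K" for x y
    using that freshmans_dream'[of "2 ^ k" k x y] char by simp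
  show "x * y \<in> ?K" if "x \<in> ?K" "y \<in> ?K" for x y
    using that by (simp add: power_mult_distrib)
qed

lemma card_squared_le_NRD:
  fixes F :: "('a \<times> 'a) set"
  assumes J: "J \<subset> {1..9}" "proj J BoolBCK_plus \<noteq> proj J BoolBCK"
    and F: "finite F" "C4_free F" "card (fst ` F) \<le> b" "card (snd ` F) \<le> b"
    and n: "9 * (b * card F) \<le> n"
  shows "card F ^ 2 \<le> NRD {0, 1} (card J) (proj J BoolBCK) (proj J BoolBCK_plus) n"
proof -
  obtain i where "i \<in> {1..9}" "i \<notin> J"
    using J(1) by blast
  define c0 where "c0 = i - 1"
  have "Suc c0 \<notin> J" "c0 < 9"
    using \<open>i \<in> {1..9}\<close> \<open>i \<notin> J\<close> by (auto simp: c0_def)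
  from scheme_exists[OF \<open>c0 < 9\<close>] obtain \<kappa> T where T: "scheme_on c0 \<kappa> T"
    by (elim exE)
  define w where "w e x = (flag_dist F (fst e) (fst x), flag_dist F (snd e) (snd x))"
    for e x :: "('a \<times> 'a) \<times> ('a \<times> 'a)"
  have w_in: "w e x \<in> {..<6} \<times> {..<6}" for e x
    by (simp add: w_def flag_dist_less)
  have "card (F \<times> F) \<le> NRD {0, 1} (card J) (proj J (BoolBCK_plus - {id_matrix})) (proj J BoolBCK_plus) n"
  proof (rule card_le_NRD_proj[where N = 9 and M = "\<lambda>e x. T (w e x)" and f = "\<lambda>c. vertex (\<kappa> c)"])
    show "J \<subseteq> {1..9}"
      using J(1) by blast
    show "BoolBCK_plus \<subseteq> tuples 9 {0, 1}"
      by (auto simp: BoolBCK_plus_def tuples_def)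
    show "id_matrix \<in> BoolBCK_plus"
      by (simp add: BoolBCK_plus_def)
    show "proj J BoolBCK_plus \<noteq> proj J (BoolBCK_plus - {id_matrix})"
      using J(2) by (simp add: BoolBCK_def)
    show "finite (F \<times> F)"
      using F(1) by simp
    show "T (w e x) \<in> BoolBCK_plus" for e x
      by (rule scheme_onD[OF T w_in])
    show "T (w e x) = id_matrix \<longleftrightarrow> x = e" for e x
      using scheme_onD(2)[OF T w_in] by (auto simp: w_def flag_dist_eq_0_iff prod_eq_iff)
    show "T (w e x) ! c = T (w e y) ! c"
      if "e \<in> F \<times> F" "x \<in> F \<times> F" "y \<in> F \<times> F" "Suc c \<in> J" "vertex (\<kappa> c) x = vertex (\<kappa> c) y"
      for e x y c
    proof -
      have "c < 9" "c \<noteq> c0"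
        using \<open>Suc c \<in> J\<close> \<open>Suc c0 \<notin> J\<close> J(1) by auto
      then have "T (w e x) ! c = T (panel (\<kappa> c) (w e x)) ! c"
        by (rule scheme_onD(3)[OF T w_in])
      \<comment> \<open>Both edges are compared through the common even end of their side.\<close>
      also have "panel (\<kappa> c) (w e x) = panel (\<kappa> c) (w e y)"
        unfolding w_def using that F(2) by (intro panel_flag_dist) auto
      also have "T \<dots> ! c = T (w e y) ! c"
        using \<open>c < 9\<close> \<open>c \<noteq> c0\<close> by (rule scheme_onD(3)[OF T w_in, symmetric])
      finally show ?thesis .
    qed
    \<comment> \<open>At most nine positions, each with at most \<open>b * card F\<close>
      vertices.\<close>
    have "{c. Suc c \<in> J} \<subseteq> {..<9}"
      using J(1) by auto
    then have "card {c. Suc c \<in> J} \<le> 9"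
      using card_mono[of "{..<9::nat}"] by simp
    moreover have "(\<Sum>c | Suc c \<in> J. card (vertex (\<kappa> c) ` (F \<times> F))) \<le> card {c. Suc c \<in> J} * (b * card F)"
      using sum_bounded_above[of "{c. Suc c \<in> J}" "\<lambda>c. card (vertex (\<kappa> c) ` (F \<times> F))" "b * card F"]
        card_vertex_image_le[OF F(1,3,4)] by simp
    ultimately show "(\<Sum>c | Suc c \<in> J. card (vertex (\<kappa> c) ` (F \<times> F))) \<le> n"
      using n by (meson mult_le_mono1 order.trans)
  qed simp
  then show ?thesis
    by (simp add: BoolBCK_def card_cartesian_product power2_eq_square)
qed

lemma C4_free_exists:
  fixes k :: nat
  assumes "k > 0"
  obtains F :: "((bit alg_closure \<times> bit alg_closure) \<times> (bit alg_closure \<times> bit alg_closure)) set"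
  where "finite F" "C4_free F" "card F = (2 ^ k) ^ 3"
    "card (fst ` F) \<le> (2 ^ k) ^ 2" "card (snd ` F) \<le> (2 ^ k) ^ 2"
proof -
  obtain K :: "bit alg_closure set" where K: "card K = 2 ^ k"
    "\<And>x y. x \<in> K \<Longrightarrow> y \<in> K \<Longrightarrow> x + y \<in> K" "\<And>x y. x \<in> K \<Longrightarrow> y \<in> K \<Longrightarrow> x * y \<in> K"
    using finite_subfield_exists[OF assms] by blast
  have "finite K"
    using K(1) by (intro card_ge_0_finite) simp
  \<comment> \<open>A flag is given by the abscissa \<open>a\<close> of its point and the slope
    \<open>s\<close> and intercept \<open>t\<close> of its line.\<close>
  define flag where "flag = (\<lambda>(a :: bit alg_closure, s, t). ((a, s * a + t), (s, t)))"
  define F where "F = flag ` (K \<times> K \<times> K)"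
  have F_iff: "((a, y), (s, t)) \<in> F \<longleftrightarrow> a \<in> K \<and> s \<in> K \<and> t \<in> K \<and> y = s * a + t" for a y s t
    by (auto simp: F_def flag_def image_iff)
  have "inj_on flag (K \<times> K \<times> K)"
    by (auto simp: flag_def inj_on_def)
  then have "card F = (2 ^ k) ^ 3"
    using K(1) by (simp add: F_def card_image card_cartesian_product power3_eq_cube)
  moreover have "finite F"
    using \<open>finite K\<close> by (simp add: F_def)
  moreover have "C4_free F"
    unfolding C4_free_def
  proof (intro allI impI)
    fix p p' l l' :: "bit alg_closure \<times> bit alg_closure"
    assume in_F: "(p, l) \<in> F" "(p, l') \<in> F" "(p', l) \<in> F" "(p', l') \<in> F"
    obtain a y a' y' s t s' t' where eqs: "p = (a, y)" "p' = (a', y')" "l = (s, t)" "l' = (s', t')"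
      by (metis surj_pair)
    have y: "y = s * a + t" "y = s' * a + t'" "y' = s * a' + t" "y' = s' * a' + t'"
      using in_F by (simp_all only: eqs F_iff)
    \<comment> \<open>Two lines meeting at two abscissas have equal slopes; the product is a second
      difference of the four incidence equations.\<close>
    have "(s - s') * (a - a') = (s * a + t - (s' * a + t')) - (s * a' + t - (s' * a' + t'))"
      by (simp add: algebra_simps)
    also have "\<dots> = 0"
      by (simp flip: y(1,3) add: y(2)[symmetric] y(4)[symmetric])
    finally have "(s - s') * (a - a') = 0" .
    then have "s = s' \<or> a = a'"
      by simp
    then show "p = p' \<or> l = l'"
      using y by (auto simp: eqs)
  qed
  moreover have "card A \<le> (2 ^ k) ^ 2" if "A \<subseteq> K \<times> K" for A
    using card_mono[OF _ that] \<open>finite K\<close> K(1)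
    by (simp add: card_cartesian_product power2_eq_square)
  moreover have "fst ` F \<subseteq> K \<times> K" "snd ` F \<subseteq> K \<times> K"
    using K(2,3) by (auto simp: F_def flag_def)
  ultimately show ?thesis
    using that by blast
qed

section \<open>From dyadic sizes to all \<open>n\<close>\<close>

text \<open>Rounding down to the largest admissible \<open>2 ^ k\<close> loses only a constant:
  \<open>n\<close> is below \<open>C * (2 ^ Suc k) ^ b\<close>, which explains the factor
  \<open>C * 2 ^ b\<close> in \<open>c\<close>.\<close>

lemma bigomega_powr_of_dyadic:
  fixes f :: "nat \<Rightarrow> nat"
  assumes "C > 0" "b > 0"
    and f: "\<And>k n. k > 0 \<Longrightarrow> C * (2 ^ k) ^ b \<le> n \<Longrightarrow> (2 ^ k) ^ a \<le> f n"
  shows "(\<lambda>n. real (f n)) \<in> \<Omega>(\<lambda>n. real n powr (real a / real b))"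
proof (rule landau_omega.bigI)
  define e where "e = real a / real b"
  define c where "c = real (C * 2 ^ b) powr e"
  show "inverse c > 0"
    using \<open>C > 0\<close> by (simp add: c_def)
  have "real (f n) \<ge> inverse c * real n powr e" if n: "n \<ge> C * 2 ^ b" for n
  proof -
    define m where "m = (LEAST m. n < C * (2 ^ m) ^ b)"
    have "n < 2 ^ n"
      by (rule less_exp)
    also have "\<dots> \<le> (2 ^ n) ^ b"
      using \<open>b > 0\<close> by (intro self_le_power) simp_all
    also have "\<dots> \<le> C * (2 ^ n) ^ b"
      using \<open>C > 0\<close> by simp
    finally have m: "n < C * (2 ^ m) ^ b" and least: "\<And>k. k < m \<Longrightarrow> C * (2 ^ k) ^ b \<le> n"
      unfolding m_def by (rule LeastI, use not_less_Least not_less in blast)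
    \<comment> \<open>This gives \<open>k > 0\<close> for \<open>k = m - 1\<close>, as
      \<open>f\<close> requires.\<close>
    have "m > 1"
    proof (rule ccontr)
      assume "\<not> m > 1"
      then have "C * (2 ^ m) ^ b \<le> C * 2 ^ b"
        by (cases m) (auto simp: power_mono)
      with m n show False
        by simp
    qed
    then obtain k where k: "m = Suc k" "k > 0"
      by (cases m) auto
    have "real n \<le> real (C * 2 ^ b) * (2 ^ k) ^ b"
      using less_imp_le[OF m] unfolding k(1) power_Suc power_mult_distrib of_nat_le_iff[symmetric, where ?'a = real]
      by (simp add: mult.assoc)
    then have "real n powr e \<le> (real (C * 2 ^ b) * (2 ^ k) ^ b) powr e"
      by (intro powr_mono2) (simp_all add: e_def)
    also have "\<dots> = c * ((2 ^ k) ^ b) powr e"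
      by (simp add: c_def powr_mult)
    also have "(((2 :: real) ^ k) ^ b) powr e = (2 ^ k) ^ a"
    proof -
      have "(((2 :: real) ^ k) ^ b) powr e = (2 ^ k) powr (real b * e)"
        by (simp add: powr_powr mult.assoc flip: powr_realpow)
      also have "real b * e = real a"
        using \<open>b > 0\<close> by (simp add: e_def)
      finally show ?thesis
        by (simp add: powr_realpow)
    qed
    also have "c * (2 ^ k) ^ a \<le> c * real (f n)"
    proof -
      have "(2 ^ k) ^ a \<le> f n"
        using f k least by simp
      then have "real ((2 ^ k) ^ a) \<le> real (f n)"
        by (simp only: of_nat_le_iff)
      then show ?thesis
        by (intro mult_left_mono) (simp_all add: c_def)
    qed
    finally show ?thesis
      using \<open>inverse c > 0\<close> by (simp add: field_simps)
  qed
  then show "eventually (\<lambda>n. norm (real (f n)) \<ge> inverse c * norm (real n powr (real a / real b))) sequentially"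
    unfolding eventually_sequentially e_def[symmetric] by auto
qed

theorem theorem4p6:
  fixes J :: "nat set"
  assumes "J \<subset> {1..9}"
    and "proj J BoolBCK_plus \<noteq> proj J BoolBCK"
  shows "(\<lambda>n. real (NRD {0, 1} (card J) (proj J BoolBCK) (proj J BoolBCK_plus) n))
           \<in> \<Omega>(\<lambda>n. real n powr (6 / 5))"
proof -
  \<comment> \<open>For \<open>q = 2 ^ k\<close> there are \<open>q ^ 6\<close> pairs of flags, and
    at most \<open>9 * (q ^ 2 * q ^ 3)\<close> vertices.\<close>
  have "(2 ^ k) ^ 6 \<le> NRD {0, 1} (card J) (proj J BoolBCK) (proj J BoolBCK_plus) n"
    if "k > 0" and n: "9 * (2 ^ k) ^ 5 \<le> n" for k n :: nat
  proof -
    obtain F :: "((bit alg_closure \<times> bit alg_closure) \<times> (bit alg_closure \<times> bit alg_closure)) set"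
      where F: "finite F" "C4_free F" "card F = (2 ^ k) ^ 3"
        "card (fst ` F) \<le> (2 ^ k) ^ 2" "card (snd ` F) \<le> (2 ^ k) ^ 2"
      using C4_free_exists[OF \<open>k > 0\<close>] by blast
    have "9 * ((2 ^ k) ^ 2 * card F) \<le> n"
      using n F(3) by (simp flip: power_add)
    from card_squared_le_NRD[OF assms F(1,2,4,5) this] show ?thesis
      by (simp add: F(3) mult.commute flip: power_mult)
  qed
  from bigomega_powr_of_dyadic[of 9 5 6, OF _ _ this] show ?thesis
    by simp
qed

end
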